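(* Let $n\ge 1$ and let $\mathcal{A}_{\mathrm{NCP}}:\mathbb{C}^{2^n\times 2^n}\to\mathbb{C}^{2^n\times 2^n}$ be an $n$-qubit trace-preserving NCP map. Then there exist nonzero values $\alpha_i,\beta_i,\gamma_i\in[-1,1]\setminus\{0\}$, $i=1,\dots,n$, such that the composition $$\big(\mathcal{L}_{\alpha_1,\beta_1,\gamma_1}\otimes\cdots\otimes\mathcal{L}_{\alpha_n,\beta_n,\gamma_n}\big)\circ\mathcal{A}_{\mathrm{NCP}}$$ is completely positive, where $\mathcal{L}_{\alpha_i,\beta_i,\gamma_i}$ is the asymmetric depolarizing map acting on the $i$-th qubit.
   Context: A map $\mathcal{A}$ between complex matrix algebras is called NCP (non completely positive) if it is linear and Hermiticity-preserving (maps Hermitian matrices to Hermitian matrices) but is not completely positive (CP). It is trace preserving if $\mathrm{tr}\,\mathcal{A}(X)=\mathrm{tr}\,X$ for all $X$. For real $\alpha,\beta,\gamma\in[-1,1]$, the single-qubit asymmetric depolarizing map $\mathcal{L}_{\alpha,\beta,\gamma}:\mathbb{C}^{2\times 2}\to\mathbb{C}^{2\times 2}$ is the linear map determined by $$\mathcal{L}_{\alpha,\beta,\gamma}(\mathbb{I})=\mathbb{I},\quad \mathcal{L}_{\alpha,\beta,\gamma}(\sigma_x)=\alpha\sigma_x,\quad \mathcal{L}_{\alpha,\beta,\gamma}(\sigma_y)=\beta\sigma_y,\quad \mathcal{L}_{\alpha,\beta,\gamma}(\sigma_z)=\gamma\sigma_z,$$ with $\sigma_x,\sigma_y,\sigma_z$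 the Pauli matrices. Equivalently, $$\mathcal{L}_{\alpha,\beta,\gamma}(\rho)=\tfrac14\big[(1+\alpha+\beta+\gamma)\rho+(1+\alpha-\beta-\gamma)\sigma_x\rho\sigma_x+(1-\alpha+\beta-\gamma)\sigma_y\rho\sigma_y+(1-\alpha-\beta+\gamma)\sigma_z\rho\sigma_z\big].$$ The space $\mathbb{C}^{2^n\times 2^n}$ is identified with $(\mathbb{C}^{2\times 2})^{\otimes n}$, one factor per qubit. *)

theory Defs
  imports Complex_Main "Jordan_Normal_Form.Schur_Decomposition"
begin

section \<open>Linear maps on complex matrix algebras\<close>

text \<open>
  A map on the d-by-d complex matrices is a function on the type \<open>complex mat\<close> of matrices
  of arbitrary size; only its values on \<open>carrier_mat d d\<close> matter.
\<close>

definition mat_linear :: "nat \<Rightarrow> (complex mat \<Rightarrow> complex mat) \<Rightarrow> bool" where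
  "mat_linear d F \<longleftrightarrow>
     (\<forall>X\<in>carrier_mat d d. F X \<in> carrier_mat d d) \<and>
     (\<forall>X\<in>carrier_mat d d. \<forall>Y\<in>carrier_mat d d. F (X + Y) = F X + F Y) \<and>
     (\<forall>c. \<forall>X\<in>carrier_mat d d. F (c \<cdot>\<^sub>m X) = c \<cdot>\<^sub>m F X)"

definition hermitian_mat :: "nat \<Rightarrow> complex mat \<Rightarrow> bool" where
  "hermitian_mat d X \<longleftrightarrow> X \<in> carrier_mat d d \<and> mat_adjoint X = X"

text \<open>The order on \<open>complex\<close> is the one in which \<open>0 \<le> z\<close> says that z is real and nonnegative.\<close>

definition psd_mat :: "nat \<Rightarrow> complex mat \<Rightarrow> bool" where
  "psd_mat d X \<longleftrightarrow> hermitian_mat d X \<and> (\<forall>v\<in>carrier_vec d. 0 \<le> (X *\<^sub>v v) \<bullet>c v)"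

definition mat_trace :: "complex mat \<Rightarrow> complex" where
  "mat_trace X = (\<Sum>i<dim_row X. X $$ (i, i))"

definition hermiticity_preserving :: "nat \<Rightarrow> (complex mat \<Rightarrow> complex mat) \<Rightarrow> bool" where
  "hermiticity_preserving d F \<longleftrightarrow> (\<forall>X. hermitian_mat d X \<longrightarrow> hermitian_mat d (F X))"

definition trace_preserving :: "nat \<Rightarrow> (complex mat \<Rightarrow> complex mat) \<Rightarrow> bool" where
  "trace_preserving d F \<longleftrightarrow> (\<forall>X\<in>carrier_mat d d. mat_trace (F X) = mat_trace X)"


section \<open>Tensor products\<close>

definition kron :: "complex mat \<Rightarrow> complex mat \<Rightarrow> complex mat" where
  "kron A B = mat (dim_row A * dim_row B) (dim_col A * dim_col B)
     (\<lambda>(r, s). A $$ (r div dim_row B, s div dim_col B) * B $$ (r mod dim_row B, s mod dim_col B))"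

definition mat_unit :: "nat \<Rightarrow> nat \<Rightarrow> nat \<Rightarrow> complex mat" where
  "mat_unit d i j = mat d d (\<lambda>rs. if rs = (i, j) then 1 else 0)"

text \<open>
  The tensor product of a map F on p-by-p matrices and a map G on q-by-q matrices, defined by
  linear extension from the basis \<open>kron (mat_unit p i j) (mat_unit q k l)\<close>, whose only nonzero
  entry is at \<open>(i * q + k, j * q + l)\<close>. It is characterised by
  \<open>mat_linear_map_tensor\<close> (linearity) and \<open>map_tensor_kron\<close> (value on Kronecker products).
\<close>

definition map_tensor ::
  "nat \<Rightarrow> nat \<Rightarrow> (complex mat \<Rightarrow> complex mat) \<Rightarrow> (complex mat \<Rightarrow> complex mat) \<Rightarrow> complex mat \<Rightarrow> complex mat"
where
  "map_tensor p q F G X = mat (p * q) (p * q)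
     (\<lambda>rs. \<Sum>i<p. \<Sum>j<p. \<Sum>k<q. \<Sum>l<q.
        X $$ (i * q + k, j * q + l) * kron (F (mat_unit p i j)) (G (mat_unit q k l)) $$ rs)"

lemma mat_linear_expand:
  assumes F: "mat_linear d F" and A: "A \<in> carrier_mat d d" and rs: "r < d" "s < d"
  shows "F A $$ (r, s) = (\<Sum>i<d. \<Sum>j<d. A $$ (i, j) * F (mat_unit d i j) $$ (r, s))"
proof -
  have Fc: "F X \<in> carrier_mat d d" if "X \<in> carrier_mat d d" for X
    using F that by (auto simp: mat_linear_def)
  have Fadd: "F (X + Y) = F X + F Y" if "X \<in> carrier_mat d d" "Y \<in> carrier_mat d d" for X Y
    using F that by (auto simp: mat_linear_def)
  have Fsm: "F (c \<cdot>\<^sub>m X) = c \<cdot>\<^sub>m F X" if "X \<in> carrier_mat d d" for c X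
    using F that by (auto simp: mat_linear_def)
  define R where "R S = mat d d (\<lambda>ij. if ij \<in> S then A $$ ij else 0)" for S
  have Rc: "R S \<in> carrier_mat d d" for S by (simp add: R_def)
  have uc: "mat_unit d i j \<in> carrier_mat d d" for i j by (simp add: mat_unit_def)
  have *: "F (R S) $$ (r, s) = (\<Sum>(i, j)\<in>S. A $$ (i, j) * F (mat_unit d i j) $$ (r, s))"
    if "finite S" "S \<subseteq> {..<d} \<times> {..<d}" for S
    using that
  proof (induction S rule: finite_induct)
    case empty
    have "R {} = 0 \<cdot>\<^sub>m R {}" by (auto simp: R_def)
    then have "F (R {}) = 0 \<cdot>\<^sub>m F (R {})" using Fsm[OF Rc, of 0 "{}"] by simp
    then have "F (R {}) $$ (r, s) = (0 \<cdot>\<^sub>m F (R {})) $$ (r, s)" by (rule arg_cong)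
    also have "\<dots> = 0" using Fc[OF Rc, of "{}"] rs by simp
    finally show ?case by simp
  next
    case (insert x S)
    obtain i j where x: "x = (i, j)" by (cases x)
    have "R (insert x S) = A $$ (i, j) \<cdot>\<^sub>m mat_unit d i j + R S"
      using insert.hyps x by (intro eq_matI) (auto simp: R_def mat_unit_def)
    then have "F (R (insert x S)) = A $$ (i, j) \<cdot>\<^sub>m F (mat_unit d i j) + F (R S)"
      using Fadd[OF smult_carrier_mat[OF uc] Rc] Fsm[OF uc] by simp
    then show ?case
      using insert x Fc[OF uc, of i j] Fc[OF Rc, of S] rs by simp
  qed
  have "R ({..<d} \<times> {..<d}) = A"
    using A by (intro eq_matI) (auto simp: R_def)
  with *[of "{..<d} \<times> {..<d}"] show ?thesis
    by (simp add: sum.cartesian_product)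
qed

lemma mat_linear_map_tensor: "mat_linear (p * q) (map_tensor p q F G)"
proof -
  have bd: "i * q + k < p * q" if "i < p" "k < q" for i k :: nat
  proof -
    have "i * q + k < Suc i * q" using that by simp
    also have "\<dots> \<le> p * q" using that by (intro mult_right_mono) auto
    finally show ?thesis .
  qed
  show ?thesis
    unfolding mat_linear_def
  proof (intro conjI ballI allI)
    fix X Y :: "complex mat" and c :: complex
    assume X: "X \<in> carrier_mat (p * q) (p * q)"
    show "map_tensor p q F G X \<in> carrier_mat (p * q) (p * q)" by (simp add: map_tensor_def)
    show "map_tensor p q F G (c \<cdot>\<^sub>m X) = c \<cdot>\<^sub>m map_tensor p q F G X"
    proof (rule eq_matI)
      fix r s
      assume "r < dim_row (c \<cdot>\<^sub>m map_tensor p q F G X)" "s < dim_col (c \<cdot>\<^sub>m map_tensor p q F G X)"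
      then have "r < p * q" "s < p * q" by (simp_all add: map_tensor_def)
      moreover have "(\<Sum>i<p. \<Sum>j<p. \<Sum>k<q. \<Sum>l<q. (c \<cdot>\<^sub>m X) $$ (i * q + k, j * q + l) *
            kron (F (mat_unit p i j)) (G (mat_unit q k l)) $$ (r, s)) =
          c * (\<Sum>i<p. \<Sum>j<p. \<Sum>k<q. \<Sum>l<q. X $$ (i * q + k, j * q + l) *
            kron (F (mat_unit p i j)) (G (mat_unit q k l)) $$ (r, s))"
        unfolding sum_distrib_left by (intro sum.cong refl) (use X bd in simp)
      ultimately show "map_tensor p q F G (c \<cdot>\<^sub>m X) $$ (r, s) = (c \<cdot>\<^sub>m map_tensor p q F G X) $$ (r, s)"
        by (simp add: map_tensor_def)
    qed (simp_all add: map_tensor_def)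
    assume Y: "Y \<in> carrier_mat (p * q) (p * q)"
    show "map_tensor p q F G (X + Y) = map_tensor p q F G X + map_tensor p q F G Y"
    proof (rule eq_matI)
      fix r s
      assume "r < dim_row (map_tensor p q F G X + map_tensor p q F G Y)"
        "s < dim_col (map_tensor p q F G X + map_tensor p q F G Y)"
      then have "r < p * q" "s < p * q" by (simp_all add: map_tensor_def)
      moreover have "(\<Sum>i<p. \<Sum>j<p. \<Sum>k<q. \<Sum>l<q. (X + Y) $$ (i * q + k, j * q + l) *
            kron (F (mat_unit p i j)) (G (mat_unit q k l)) $$ (r, s)) =
          (\<Sum>i<p. \<Sum>j<p. \<Sum>k<q. \<Sum>l<q. X $$ (i * q + k, j * q + l) *
            kron (F (mat_unit p i j)) (G (mat_unit q k l)) $$ (r, s)) +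
          (\<Sum>i<p. \<Sum>j<p. \<Sum>k<q. \<Sum>l<q. Y $$ (i * q + k, j * q + l) *
            kron (F (mat_unit p i j)) (G (mat_unit q k l)) $$ (r, s))"
        unfolding sum.distrib[symmetric]
        by (intro sum.cong refl) (use X Y bd in \<open>simp add: distrib_right\<close>)
      ultimately show "map_tensor p q F G (X + Y) $$ (r, s) =
          (map_tensor p q F G X + map_tensor p q F G Y) $$ (r, s)"
        by (simp add: map_tensor_def)
    qed (simp_all add: map_tensor_def)
  qed
qed

lemma map_tensor_kron:
  assumes F: "mat_linear p F" and G: "mat_linear q G"
    and A: "A \<in> carrier_mat p p" and B: "B \<in> carrier_mat q q"
  shows "map_tensor p q F G (kron A B) = kron (F A) (G B)"
proof -
  have bd: "i * q + k < p * q" if "i < p" "k < q" for i k :: nat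
  proof -
    have "i * q + k < Suc i * q" using that by simp
    also have "\<dots> \<le> p * q" using that by (intro mult_right_mono) auto
    finally show ?thesis .
  qed
  have Fc: "F X \<in> carrier_mat p p" if "X \<in> carrier_mat p p" for X
    using F that by (auto simp: mat_linear_def)
  have Gc: "G X \<in> carrier_mat q q" if "X \<in> carrier_mat q q" for X
    using G that by (auto simp: mat_linear_def)
  have uc: "mat_unit d i j \<in> carrier_mat d d" for d i j by (simp add: mat_unit_def)
  have dims: "dim_row (F A) = p" "dim_col (F A) = p" "dim_row (G B) = q" "dim_col (G B) = q"
    using Fc[OF A] Gc[OF B] by auto
  have udims: "dim_row (F (mat_unit p i j)) = p" "dim_col (F (mat_unit p i j)) = p"
    "dim_row (G (mat_unit q i j)) = q" "dim_col (G (mat_unit q i j)) = q" for i j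
    by (rule carrier_matD[OF Fc[OF uc]] carrier_matD[OF Gc[OF uc]])+
  show ?thesis
  proof (rule eq_matI)
    fix r s
    assume "r < dim_row (kron (F A) (G B))" "s < dim_col (kron (F A) (G B))"
    then have r: "r < p * q" and s: "s < p * q" by (simp_all add: kron_def dims)
    then have q: "0 < q" by (cases q) auto
    have rs: "r div q < p" "s div q < p" "r mod q < q" "s mod q < q"
      using r s q by (auto simp: less_mult_imp_div_less)
    let ?f = "\<lambda>i j. F (mat_unit p i j) $$ (r div q, s div q)"
    let ?g = "\<lambda>k l. G (mat_unit q k l) $$ (r mod q, s mod q)"
    have "map_tensor p q F G (kron A B) $$ (r, s) =
      (\<Sum>i<p. \<Sum>j<p. \<Sum>k<q. \<Sum>l<q. A $$ (i, j) * B $$ (k, l) * (?f i j * ?g k l))"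
      using r s A B by (simp add: map_tensor_def kron_def udims bd)
    also have "\<dots> = (\<Sum>i<p. \<Sum>j<p. \<Sum>k<q. \<Sum>l<q. (A $$ (i, j) * ?f i j) * (B $$ (k, l) * ?g k l))"
      by (intro sum.cong refl) (simp only: mult_ac)
    also have "\<dots> = (\<Sum>i<p. \<Sum>j<p. A $$ (i, j) * ?f i j) * (\<Sum>k<q. \<Sum>l<q. B $$ (k, l) * ?g k l)"
      unfolding sum_distrib_right unfolding sum_distrib_left ..
    also have "\<dots> = F A $$ (r div q, s div q) * G B $$ (r mod q, s mod q)"
      using mat_linear_expand[OF F A rs(1,2)] mat_linear_expand[OF G B rs(3,4)] by simp
    also have "\<dots> = kron (F A) (G B) $$ (r, s)"
      using r s by (simp add: kron_def dims)
    finally show "map_tensor p q F G (kron A B) $$ (r, s) = kron (F A) (G B) $$ (r, s)" .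
  qed (auto simp: map_tensor_def kron_def dims)
qed

text \<open>The product \<open>F 1 \<otimes> \<dots> \<otimes> F n\<close> of single-qubit maps; qubit 1 is the most significant index.\<close>

fun qubit_tensor :: "nat \<Rightarrow> (nat \<Rightarrow> complex mat \<Rightarrow> complex mat) \<Rightarrow> complex mat \<Rightarrow> complex mat" where
  "qubit_tensor 0 F = (\<lambda>X. X)"
| "qubit_tensor (Suc n) F = map_tensor (2 ^ n) 2 (qubit_tensor n F) (F (Suc n))"


section \<open>Complete positivity\<close>

definition completely_positive :: "nat \<Rightarrow> (complex mat \<Rightarrow> complex mat) \<Rightarrow> bool" where
  "completely_positive d F \<longleftrightarrow> mat_linear d F \<and>
     (\<forall>k X. psd_mat (k * d) X \<longrightarrow> psd_mat (k * d) (map_tensor k d (\<lambda>Y. Y) F X))"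

definition ncp_map :: "nat \<Rightarrow> (complex mat \<Rightarrow> complex mat) \<Rightarrow> bool" where
  "ncp_map d F \<longleftrightarrow> mat_linear d F \<and> hermiticity_preserving d F \<and> \<not> completely_positive d F"


section \<open>Asymmetric depolarizing maps\<close>

definition pauli_x :: "complex mat" where
  "pauli_x = mat_of_rows_list 2 [[0, 1], [1, 0]]"

definition pauli_y :: "complex mat" where
  "pauli_y = mat_of_rows_list 2 [[0, - \<i>], [\<i>, 0]]"

definition pauli_z :: "complex mat" where
  "pauli_z = mat_of_rows_list 2 [[1, 0], [0, - 1]]"

definition depolarizing :: "real \<Rightarrow> real \<Rightarrow> real \<Rightarrow> complex mat \<Rightarrow> complex mat" where
  "depolarizing \<alpha> \<beta> \<gamma> \<rho> = (1 / 4) \<cdot>\<^sub>m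
     (complex_of_real (1 + \<alpha> + \<beta> + \<gamma>) \<cdot>\<^sub>m \<rho> +
      complex_of_real (1 + \<alpha> - \<beta> - \<gamma>) \<cdot>\<^sub>m (pauli_x * \<rho> * pauli_x) +
      complex_of_real (1 - \<alpha> + \<beta> - \<gamma>) \<cdot>\<^sub>m (pauli_y * \<rho> * pauli_y) +
      complex_of_real (1 - \<alpha> - \<beta> + \<gamma>) \<cdot>\<^sub>m (pauli_z * \<rho> * pauli_z))"

lemma pauli_carrier [simp]:
  "pauli_x \<in> carrier_mat 2 2" "pauli_y \<in> carrier_mat 2 2" "pauli_z \<in> carrier_mat 2 2"
  by (auto simp: pauli_x_def pauli_y_def pauli_z_def mat_of_rows_list_def)

lemma mat_linear_depolarizing: "mat_linear 2 (depolarizing \<alpha> \<beta> \<gamma>)"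
proof -
  have conj_carrier: "P * X * P \<in> carrier_mat 2 2"
    if "P \<in> carrier_mat 2 2" "X \<in> carrier_mat 2 2" for P X :: "complex mat"
    using that by simp
  have sum4_carrier: "c \<cdot>\<^sub>m (c1 \<cdot>\<^sub>m A1 + c2 \<cdot>\<^sub>m A2 + c3 \<cdot>\<^sub>m A3 + c4 \<cdot>\<^sub>m A4) \<in> carrier_mat 2 2"
    if "A4 \<in> carrier_mat 2 2" for c c1 c2 c3 c4 and A1 A2 A3 A4 :: "complex mat"
    using that by simp
  have conj_add: "P * (X + Y) * P = P * X * P + P * Y * P"
    if "P \<in> carrier_mat 2 2" "X \<in> carrier_mat 2 2" "Y \<in> carrier_mat 2 2" for P X Y :: "complex mat"
    using that
    by (simp add: mult_add_distrib_mat[of _ 2 2 _ 2] add_mult_distrib_mat[of _ 2 2 _ _ 2])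
  have conj_smult: "P * (c \<cdot>\<^sub>m X) * P = c \<cdot>\<^sub>m (P * X * P)"
    if "P \<in> carrier_mat 2 2" "X \<in> carrier_mat 2 2" for c and P X :: "complex mat"
    using that
    by (simp add: mult_smult_distrib[of _ 2 2 _ 2] mult_smult_assoc_mat[of _ 2 2 _ 2])
  note cx = pauli_carrier[THEN conj_carrier]
  show ?thesis
    unfolding mat_linear_def
  proof (intro conjI ballI allI)
    fix X Y :: "complex mat" and c :: complex
    assume X: "X \<in> carrier_mat 2 2"
    show "depolarizing \<alpha> \<beta> \<gamma> X \<in> carrier_mat 2 2"
      unfolding depolarizing_def by (intro sum4_carrier conj_carrier pauli_carrier X)
    show "depolarizing \<alpha> \<beta> \<gamma> (c \<cdot>\<^sub>m X) = c \<cdot>\<^sub>m depolarizing \<alpha> \<beta> \<gamma> X"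
      using X carrier_matD[OF cx(1)[OF X]] carrier_matD[OF cx(2)[OF X]] carrier_matD[OF cx(3)[OF X]]
      unfolding depolarizing_def
      by (simp only: conj_smult pauli_carrier) (intro eq_matI, simp_all add: algebra_simps)
    assume Y: "Y \<in> carrier_mat 2 2"
    show "depolarizing \<alpha> \<beta> \<gamma> (X + Y) = depolarizing \<alpha> \<beta> \<gamma> X + depolarizing \<alpha> \<beta> \<gamma> Y"
      using X Y carrier_matD[OF cx(1)[OF X]] carrier_matD[OF cx(2)[OF X]] carrier_matD[OF cx(3)[OF X]]
        carrier_matD[OF cx(1)[OF Y]] carrier_matD[OF cx(2)[OF Y]] carrier_matD[OF cx(3)[OF Y]]
      unfolding depolarizing_def
      by (simp only: conj_add pauli_carrier) (intro eq_matI, simp_all add: algebra_simps)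
  qed
qed

lemma depolarizing_pauli:
  "depolarizing \<alpha> \<beta> \<gamma> (1\<^sub>m 2) = 1\<^sub>m 2"
  "depolarizing \<alpha> \<beta> \<gamma> pauli_x = complex_of_real \<alpha> \<cdot>\<^sub>m pauli_x"
  "depolarizing \<alpha> \<beta> \<gamma> pauli_y = complex_of_real \<beta> \<cdot>\<^sub>m pauli_y"
  "depolarizing \<alpha> \<beta> \<gamma> pauli_z = complex_of_real \<gamma> \<cdot>\<^sub>m pauli_z"
proof -
  have eqI: "A = B"
    if "A \<in> carrier_mat 2 2" "B \<in> carrier_mat 2 2"
      "A $$ (0, 0) = B $$ (0, 0)" "A $$ (0, 1) = B $$ (0, 1)"
      "A $$ (1, 0) = B $$ (1, 0)" "A $$ (1, 1) = B $$ (1, 1)" for A B :: "complex mat"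
    using that by (intro eq_matI) (auto simp: less_2_cases_iff)
  have mult: "(A * B) $$ (i, j) = A $$ (i, 0) * B $$ (0, j) + A $$ (i, 1) * B $$ (1, j)"
    if "A \<in> carrier_mat 2 2" "B \<in> carrier_mat 2 2" "i < 2" "j < 2" for A B :: "complex mat" and i j
    using that by (simp add: scalar_prod_def numeral_2_eq_2)
  have entries:
    "pauli_x $$ (0, 0) = 0" "pauli_x $$ (0, 1) = 1" "pauli_x $$ (1, 0) = 1" "pauli_x $$ (1, 1) = 0"
    "pauli_y $$ (0, 0) = 0" "pauli_y $$ (0, 1) = - \<i>" "pauli_y $$ (1, 0) = \<i>" "pauli_y $$ (1, 1) = 0"
    "pauli_z $$ (0, 0) = 1" "pauli_z $$ (0, 1) = 0" "pauli_z $$ (1, 0) = 0" "pauli_z $$ (1, 1) = - 1"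
    by (simp_all add: pauli_x_def pauli_y_def pauli_z_def mat_of_rows_list_def)
  have pc: "P * X \<in> carrier_mat 2 2" if "P \<in> carrier_mat 2 2" "X \<in> carrier_mat 2 2" for P X :: "complex mat"
    using that by simp
  have L: "depolarizing \<alpha> \<beta> \<gamma> X \<in> carrier_mat 2 2" if "X \<in> carrier_mat 2 2" for X
    using mat_linear_depolarizing that by (auto simp: mat_linear_def)
  have Lij: "depolarizing \<alpha> \<beta> \<gamma> X $$ (i, j) = 1 / 4 *
     (complex_of_real (1 + \<alpha> + \<beta> + \<gamma>) * X $$ (i, j) +
      complex_of_real (1 + \<alpha> - \<beta> - \<gamma>) * (pauli_x * X * pauli_x) $$ (i, j) +
      complex_of_real (1 - \<alpha> + \<beta> - \<gamma>) * (pauli_y * X * pauli_y) $$ (i, j) +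
      complex_of_real (1 - \<alpha> - \<beta> + \<gamma>) * (pauli_z * X * pauli_z) $$ (i, j))"
    if "X \<in> carrier_mat 2 2" "i < 2" "j < 2" for X i j
    using carrier_matD[OF that(1)] carrier_matD[OF pauli_carrier(1)] carrier_matD[OF pauli_carrier(2)]
      carrier_matD[OF pauli_carrier(3)] that(2,3)
    by (simp add: depolarizing_def del: index_mult_mat(1))
  note ent = Lij mult pc entries
  show "depolarizing \<alpha> \<beta> \<gamma> (1\<^sub>m 2) = 1\<^sub>m 2"
    by (rule eqI) (simp_all add: L ent del: index_mult_mat(1) One_nat_def)
  show "depolarizing \<alpha> \<beta> \<gamma> pauli_x = complex_of_real \<alpha> \<cdot>\<^sub>m pauli_x"
    by (rule eqI) (simp_all add: L ent pauli_carrier[THEN carrier_matD(1)] pauli_carrier[THEN carrier_matD(2)]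
        del: index_mult_mat(1) One_nat_def)
  show "depolarizing \<alpha> \<beta> \<gamma> pauli_y = complex_of_real \<beta> \<cdot>\<^sub>m pauli_y"
    by (rule eqI) (simp_all add: L ent pauli_carrier[THEN carrier_matD(1)] pauli_carrier[THEN carrier_matD(2)]
        algebra_simps del: index_mult_mat(1) One_nat_def)
  show "depolarizing \<alpha> \<beta> \<gamma> pauli_z = complex_of_real \<gamma> \<cdot>\<^sub>m pauli_z"
    by (rule eqI) (simp_all add: L ent pauli_carrier[THEN carrier_matD(1)] pauli_carrier[THEN carrier_matD(2)]
        del: index_mult_mat(1) One_nat_def)
qed

end

theory Submission
  imports Defs
begin

text \<open>
  Take all parameters equal to one \<open>t > 0\<close>. As t tends to 0, the tensor product of the depolarizing
  maps tends to \<open>X \<mapsto> tr X / d \<cdot> 1\<close> with \<open>d = 2 ^ n\<close>, so by trace preservation its composition with A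
  also tends to that map, whose Choi matrix \<open>1 / d\<close> is positive definite. A Hermiticity-preserving map
  whose Choi matrix is entrywise within \<open>1 / d ^ 3\<close> of \<open>1 / d\<close> is completely positive: applying it to
  one factor of a positive semidefinite X gives the quadratic form
  \<open>\<Sum>p q. K p q * \<langle>w p, X w q\<rangle>\<close> with Choi entries \<open>K p q\<close>, and the \<open>d\<^sup>2\<close> cross terms in each row are
  dominated by the diagonal because \<open>2 \<bar>\<langle>w p, X w q\<rangle>\<bar> \<le> \<langle>w p, X w p\<rangle> + \<langle>w q, X w q\<rangle>\<close>.
\<close>

section \<open>Hermitian and positive semidefinite matrices through their entries\<close>

lemma hermitian_mat_iff:
  "hermitian_mat N X \<longleftrightarrow>
     X \<in> carrier_mat N N \<and> (\<forall>m<N. \<forall>l<N. cnj (X $$ (m, l)) = X $$ (l, m))"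
proof (cases "X \<in> carrier_mat N N")
  case True
  have "mat_adjoint X \<in> carrier_mat N N"
    using True by (auto simp: mat_adjoint_def mat_of_rows_def)
  then have "mat_adjoint X = X \<longleftrightarrow>
      (\<forall>m<N. \<forall>l<N. mat_adjoint X $$ (l, m) = X $$ (l, m))"
    using True by (subst mat_eq_iff) auto
  moreover have "mat_adjoint X $$ (l, m) = cnj (X $$ (m, l))" if "m < N" "l < N" for m l
    using that True by (auto simp: mat_adjoint_def mat_of_rows_def)
  ultimately show ?thesis
    using True by (simp add: hermitian_mat_def)
qed (simp add: hermitian_mat_def)

text \<open>This is the form \<open><x, X y>\<close>, antilinear in \<open>x\<close>. Vectors are
  plain functions, so no carrier conditions arise and product indices can be plugged in directly;
  only values below \<open>N\<close> matter.\<close>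

definition sesq :: "nat \<Rightarrow> complex mat \<Rightarrow> (nat \<Rightarrow> complex) \<Rightarrow> (nat \<Rightarrow> complex) \<Rightarrow> complex" where
  "sesq N X x y = (\<Sum>m<N. \<Sum>l<N. X $$ (m, l) * cnj (x m) * y l)"

lemma sesq_cnj:
  assumes "hermitian_mat N X"
  shows "cnj (sesq N X x y) = sesq N X y x"
proof -
  have "cnj (sesq N X x y) = (\<Sum>m<N. \<Sum>l<N. X $$ (l, m) * cnj (y l) * x m)"
    unfolding sesq_def cnj_sum
    by (intro sum.cong refl) (use assms in \<open>auto simp: hermitian_mat_iff\<close>)
  also have "\<dots> = sesq N X y x"
    unfolding sesq_def by (rule sum.swap)
  finally show ?thesis .
qed

lemma sesq_add_scaled:
  "sesq N X (\<lambda>i. x i + c * y i) (\<lambda>i. x i + c * y i) =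
     sesq N X x x + c * sesq N X x y + cnj c * sesq N X y x + (cnj c * c) * sesq N X y y"
  unfolding sesq_def sum_distrib_left sum.distrib[symmetric]
  by (intro sum.cong refl) (simp add: algebra_simps)

text \<open>The order on complex numbers also asks for a vanishing imaginary part, which hermiticity
  supplies, so a condition on the real part is enough.\<close>

lemma psd_mat_iff:
  "psd_mat N X \<longleftrightarrow> hermitian_mat N X \<and> (\<forall>x. 0 \<le> Re (sesq N X x x))"
proof -
  have quad: "(X *\<^sub>v v) \<bullet>c v = sesq N X (($) v) (($) v)"
    if "X \<in> carrier_mat N N" "v \<in> carrier_vec N" for v
    using that unfolding sesq_def
    by (auto simp: scalar_prod_def sum_distrib_left sum_distrib_right atLeast0LessThan mult_ac intro!: sum.cong)
  have vecq: "sesq N X x x = sesq N X (($) (vec N x)) (($) (vec N x))" for x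
    unfolding sesq_def by (intro sum.cong refl) simp
  have real: "Im (sesq N X x x) = 0" if "hermitian_mat N X" for x
    using sesq_cnj[OF that, of x x] by (simp add: complex_eq_iff)
  show ?thesis
  proof (cases "hermitian_mat N X")
    case True
    then have X: "X \<in> carrier_mat N N" by (simp add: hermitian_mat_def)
    have "(\<forall>v\<in>carrier_vec N. 0 \<le> (X *\<^sub>v v) \<bullet>c v) \<longleftrightarrow> (\<forall>x. 0 \<le> Re (sesq N X x x))"
      using vecq[symmetric] by (auto simp: quad[OF X] less_eq_complex_def real[OF True])
        (metis vecq vec_carrier)
    with True show ?thesis by (simp add: psd_mat_def)
  qed (simp add: psd_mat_def)
qed

text \<open>The form is nonnegative at \<open>x + c * y\<close>, and a suitable \<open>c\<close> of
  modulus one makes both cross terms equal. This additive substitute for Cauchy-Schwarz can be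
  summed over pairs.\<close>

lemma psd_cross_term:
  assumes "psd_mat N X"
  shows "2 * cmod (sesq N X x y) \<le> Re (sesq N X x x) + Re (sesq N X y y)"
proof -
  define z where "z = sesq N X x y"
  \<comment> \<open>the phase that turns the cross term into \<open>- cmod z\<close>\<close>
  define c where "c = (if z = 0 then 1 else - cnj z / cmod z)"
  \<comment> \<open>The value 1 for \<open>z = 0\<close> matters here, since the quotient would then
    be 0.\<close>
  have "cmod c = 1" by (simp add: c_def norm_divide)
  then have unit: "cnj c * c = 1"
    by (simp add: mult.commute[of "cnj c"] flip: complex_norm_square)
  have "cnj z * z = complex_of_real (cmod z) * complex_of_real (cmod z)"
    by (simp add: mult.commute[of "cnj z"] power2_eq_square flip: complex_norm_square)
  then have "c * z = - complex_of_real (cmod z)"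
    by (cases "z = 0") (simp_all add: c_def)
  moreover from this have "cnj c * cnj z = - complex_of_real (cmod z)"
    by (metis complex_cnj_complex_of_real complex_cnj_minus complex_cnj_mult)
  moreover have "sesq N X y x = cnj z"
    using assms by (simp add: z_def sesq_cnj psd_mat_iff)
  ultimately have "sesq N X (\<lambda>i. x i + c * y i) (\<lambda>i. x i + c * y i) =
      sesq N X x x - 2 * complex_of_real (cmod z) + sesq N X y y"
    unfolding sesq_add_scaled unit by (simp add: z_def)
  moreover have "0 \<le> Re (sesq N X (\<lambda>i. x i + c * y i) (\<lambda>i. x i + c * y i))"
    using assms by (simp add: psd_mat_iff)
  ultimately show ?thesis by (simp add: z_def)
qed

section \<open>Indices of tensor products\<close>

lemma sum_split_product_index:
  fixes f :: "nat \<Rightarrow> 'a::comm_monoid_add"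
  shows "(\<Sum>m<k * d. f m) = (\<Sum>a<k. \<Sum>r<d. f (a * d + r))"
proof -
  have "(\<Sum>m<k * d. f m) = (\<Sum>a<k. sum f {a * d..<a * d + d})"
    by (rule sum.nat_group[symmetric])
  also have "\<dots> = (\<Sum>a<k. \<Sum>r<d. f (a * d + r))"
  proof (rule sum.cong[OF refl])
    fix a
    show "sum f {a * d..<a * d + d} = (\<Sum>r<d. f (a * d + r))"
      using sum.shift_bounds_nat_ivl[of f 0 "a * d" d] by (simp add: atLeast0LessThan add.commute)
  qed
  finally show ?thesis .
qed

lemma product_index_less:
  assumes "a < k" "r < d"
  shows "a * d + r < k * (d::nat)"
proof -
  have "a * d + r < Suc a * d" using assms by simp
  also have "\<dots> \<le> k * d" using assms by (intro mult_right_mono) auto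
  finally show ?thesis .
qed

lemma index_kron:
  assumes "A \<in> carrier_mat p p" "B \<in> carrier_mat q q" "a < p" "r < q" "b < p" "s < q"
  shows "kron A B $$ (a * q + r, b * q + s) = A $$ (a, b) * B $$ (r, s)"
  using assms carrier_matD[OF assms(1)] carrier_matD[OF assms(2)]
  by (simp add: kron_def product_index_less)

lemma mat_unit_carrier [simp]: "mat_unit d i j \<in> carrier_mat d d"
  by (simp add: mat_unit_def)

lemma dim_mat_unit [simp]: "dim_row (mat_unit d i j) = d" "dim_col (mat_unit d i j) = d"
  by (simp_all add: mat_unit_def)

lemma index_mat_unit:
  "r < d \<Longrightarrow> s < d \<Longrightarrow> mat_unit d i j $$ (r, s) = (if r = i \<and> s = j then 1 else 0)"
  by (simp add: mat_unit_def)

lemma mat_linear_carrier: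
  "mat_linear d F \<Longrightarrow> X \<in> carrier_mat d d \<Longrightarrow> F X \<in> carrier_mat d d"
  by (simp add: mat_linear_def)

text \<open>Block \<open>(a, b)\<close> of the result is \<open>F\<close> applied to block
  \<open>(a, b)\<close> of \<open>X\<close>, expanded in matrix units: the factor
  \<open>mat_unit k i j\<close> at \<open>(a, b)\<close> keeps only \<open>i = a\<close> and
  \<open>j = b\<close>.\<close>

lemma index_map_tensor_id:
  assumes "mat_linear d F" "a < k" "r < d" "b < k" "s < d"
  shows "map_tensor k d (\<lambda>Y. Y) F X $$ (a * d + r, b * d + s) =
    (\<Sum>i<d. \<Sum>j<d. X $$ (a * d + i, b * d + j) * F (mat_unit d i j) $$ (r, s))"
proof -
  let ?f = "\<lambda>i j. \<Sum>p<d. \<Sum>q<d. X $$ (i * d + p, j * d + q) * F (mat_unit d p q) $$ (r, s)"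
  have "map_tensor k d (\<lambda>Y. Y) F X $$ (a * d + r, b * d + s) =
    (\<Sum>i<k. \<Sum>j<k. \<Sum>p<d. \<Sum>q<d. X $$ (i * d + p, j * d + q) *
       (mat_unit k i j $$ (a, b) * F (mat_unit d p q) $$ (r, s)))"
    using assms
    by (simp add: map_tensor_def product_index_less index_kron[of _ k _ d] mat_linear_carrier)
  also have "\<dots> = (\<Sum>i<k. \<Sum>j<k. if a = i then if b = j then ?f i j else 0 else 0)"
    by (rule sum.cong[OF refl], rule sum.cong[OF refl]) (use assms in \<open>simp add: index_mat_unit\<close>)
  also have "\<dots> = (\<Sum>i<k. if a = i then ?f i b else 0)"
    by (rule sum.cong[OF refl]) (use assms in simp)
  also have "\<dots> = ?f a b"
    using assms by simp
  finally show ?thesis .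
qed


section \<open>Complete positivity near the normalized trace map\<close>

text \<open>Diagonal dominance. With \<open>S\<close> the sum of all \<open>Re (g p p)\<close>, the
  diagonal part of \<open>K\<close> contributes \<open>c * S\<close>, while the deviations cost at
  most \<open>e / 2 * (Re (g p p) + Re (g q q))\<close> per pair, in total
  \<open>e * card P * S\<close>.\<close>

lemma Re_sum_near_diagonal_nonneg:
  fixes K g :: "'a \<Rightarrow> 'a \<Rightarrow> complex" and c e :: real
  assumes "finite P"
    and K: "\<And>p q. p \<in> P \<Longrightarrow> q \<in> P \<Longrightarrow> cmod (K p q - (if p = q then complex_of_real c else 0)) \<le> e"
    and g: "\<And>p q. p \<in> P \<Longrightarrow> q \<in> P \<Longrightarrow> 2 * cmod (g p q) \<le> Re (g p p) + Re (g q q)"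
    and ec: "e * card P \<le> c"
  shows "0 \<le> Re (\<Sum>p\<in>P. \<Sum>q\<in>P. K p q * g p q)"
proof -
  have diag: "0 \<le> Re (g p p)" if "p \<in> P" for p
    using g[OF that that] norm_ge_zero[of "g p p"] by linarith
  have term_bound: "(if p = q then c * Re (g p p) else 0) - e / 2 * (Re (g p p) + Re (g q q)) \<le> Re (K p q * g p q)"
    if "p \<in> P" "q \<in> P" for p q
  proof -
    define D where "D = K p q - (if p = q then complex_of_real c else 0)"
    have "cmod (D * g p q) \<le> e * cmod (g p q)"
      unfolding norm_mult D_def by (rule mult_right_mono[OF K[OF that]]) simp
    \<comment> \<open>That \<open>e\<close> is nonnegative follows from the bound on
      \<open>K\<close>, as it dominates a norm.\<close>
    also have "\<dots> \<le> e * ((Re (g p p) + Re (g q q)) / 2)"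
      using g[OF that] order_trans[OF norm_ge_zero K[OF that]] by (intro mult_left_mono) auto
    finally have "- (e / 2 * (Re (g p p) + Re (g q q))) \<le> Re (D * g p q)"
      using abs_Re_le_cmod[of "D * g p q"] by simp
    moreover have "K p q * g p q = D * g p q + (if p = q then c * g p p else 0)"
      by (auto simp: D_def algebra_simps)
    ultimately show ?thesis by auto
  qed
  have "0 \<le> (c - e * card P) * (\<Sum>p\<in>P. Re (g p p))"
    using ec diag by (intro mult_nonneg_nonneg sum_nonneg) auto
  also have "\<dots> = (\<Sum>p\<in>P. \<Sum>q\<in>P. (if p = q then c * Re (g p p) else 0) - e / 2 * (Re (g p p) + Re (g q q)))"
  proof -
    define S where "S = (\<Sum>p\<in>P. Re (g p p))"
    have "(\<Sum>q\<in>P. (if p = q then c * Re (g p p) else 0) - e / 2 * (Re (g p p) + Re (g q q))) =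
        c * Re (g p p) - e / 2 * (card P * Re (g p p) + S)" if "p \<in> P" for p
      using that \<open>finite P\<close>
      unfolding sum_subtractf sum_distrib_left[symmetric] sum.distrib by (simp add: S_def)
    then have "(\<Sum>p\<in>P. \<Sum>q\<in>P. (if p = q then c * Re (g p p) else 0) - e / 2 * (Re (g p p) + Re (g q q))) =
        (\<Sum>p\<in>P. c * Re (g p p) - e / 2 * (card P * Re (g p p) + S))"
      by simp
    also have "\<dots> = c * S - e / 2 * (card P * S + card P * S)"
      unfolding sum_subtractf sum_distrib_left[symmetric] sum.distrib by (simp add: S_def)
    finally show ?thesis by (simp add: S_def algebra_simps)
  qed
  also have "\<dots> \<le> (\<Sum>p\<in>P. \<Sum>q\<in>P. Re (K p q * g p q))"
    by (intro sum_mono term_bound)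
  finally show ?thesis by simp
qed

text \<open>Brings the Choi indices \<open>(i, r)\<close> and \<open>(j, s)\<close> to the outside
  and leaves the ancilla indices \<open>a\<close>, \<open>b\<close> innermost, where they form the
  entries of \<open>g\<close>.\<close>

lemma sum_reorder6:
  "(\<Sum>a\<in>A. \<Sum>r\<in>R. \<Sum>b\<in>B. \<Sum>s\<in>S. \<Sum>i\<in>I. \<Sum>j\<in>J. f a r b s i j) =
   (\<Sum>i\<in>I. \<Sum>r\<in>R. \<Sum>j\<in>J. \<Sum>s\<in>S. \<Sum>a\<in>A. \<Sum>b\<in>B. f a r b s i j)"
  unfolding sum.cartesian_product
  by (rule sum.reindex_bij_witness[where i = "\<lambda>(i, r, j, s, a, b). (a, r, b, s, i, j)"
        and j = "\<lambda>(a, r, b, s, i, j). (i, r, j, s, a, b)"]) auto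

text \<open>Both hypotheses concern the Choi matrix with row index \<open>(i, r)\<close> and column
  index \<open>(j, s)\<close>: it is Hermitian and entrywise close to \<open>1 / d\<close> times the
  identity.\<close>

lemma completely_positive_near_trace_map:
  assumes lin: "mat_linear d F"
    and herm: "\<And>i j r s. i < d \<Longrightarrow> j < d \<Longrightarrow> r < d \<Longrightarrow> s < d \<Longrightarrow>
      cnj (F (mat_unit d i j) $$ (r, s)) = F (mat_unit d j i) $$ (s, r)"
    and near: "\<And>i j r s. i < d \<Longrightarrow> j < d \<Longrightarrow> r < d \<Longrightarrow> s < d \<Longrightarrow>
      cmod (F (mat_unit d i j) $$ (r, s) - (if i = j \<and> r = s then complex_of_real (1 / d) else 0)) \<le> 1 / real d ^ 3"
  shows "completely_positive d F"
  unfolding completely_positive_def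
proof (intro conjI allI impI lin)
  fix k X
  assume psd: "psd_mat (k * d) X"
  define Y where "Y = map_tensor k d (\<lambda>Y. Y) F X"
  have Y: "Y $$ (a * d + r, b * d + s) =
      (\<Sum>i<d. \<Sum>j<d. X $$ (a * d + i, b * d + j) * F (mat_unit d i j) $$ (r, s))"
    if "a < k" "r < d" "b < k" "s < d" for a r b s
    unfolding Y_def using index_map_tensor_id[OF lin] that by blast
  have hX: "cnj (X $$ (m, l)) = X $$ (l, m)" if "m < k * d" "l < k * d" for m l
    using psd that by (simp add: psd_mat_iff hermitian_mat_iff)
  have hY: "cnj (Y $$ (a * d + r, b * d + s)) = Y $$ (b * d + s, a * d + r)"
    if "a < k" "r < d" "b < k" "s < d" for a r b s
  proof -
    have "cnj (Y $$ (a * d + r, b * d + s)) =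
      (\<Sum>i<d. \<Sum>j<d. X $$ (b * d + j, a * d + i) * F (mat_unit d j i) $$ (s, r))"
      using that by (simp add: Y hX herm product_index_less)
    also have "\<dots> = Y $$ (b * d + s, a * d + r)"
      unfolding Y[OF that(3,4,1,2)] by (rule sum.swap)
    finally show ?thesis .
  qed
  have "hermitian_mat (k * d) Y"
    unfolding hermitian_mat_iff
  proof (intro conjI allI impI)
    show "Y \<in> carrier_mat (k * d) (k * d)" by (simp add: Y_def map_tensor_def)
    fix m l
    assume "m < k * d" "l < k * d"
    moreover from this have "0 < d" by (cases d) auto
    ultimately show "cnj (Y $$ (m, l)) = Y $$ (l, m)"
      using hY[of "m div d" "m mod d" "l div d" "l mod d"] by (simp add: less_mult_imp_div_less)
  qed
  moreover have "0 \<le> Re (sesq (k * d) Y x x)" for x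
  proof -
    \<comment> \<open>\<open>w (i, r)\<close> is x with its second tensor factor contracted against \<open>e\<^sub>i e\<^sub>r\<^sup>*\<close>\<close>
    define w where "w p m = (if m mod d = fst p then x (m div d * d + snd p) else 0)" for p m
    have w: "w p (a * d + i) = (if i = fst p then x (a * d + snd p) else 0)" if "i < d" for p a i
      using that by (simp add: w_def)
    define g where "g p q = sesq (k * d) X (w p) (w q)" for p q
    define K where "K p q = F (mat_unit d (fst p) (fst q)) $$ (snd p, snd q)" for p q
    \<comment> \<open>The supports of \<open>w (i, r)\<close> and \<open>w (j, s)\<close> collapse
      the sums over the second tensor factor to \<open>m = i\<close> and
      \<open>l = j\<close>.\<close>
    have g: "g (i, r) (j, s) = (\<Sum>a<k. \<Sum>b<k. X $$ (a * d + i, b * d + j) * cnj (x (a * d + r)) * x (b * d + s))"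
      if "i < d" "j < d" for i r j s
    proof -
      have "g (i, r) (j, s) = (\<Sum>a<k. \<Sum>m<d. \<Sum>b<k. \<Sum>l<d.
          if l = j then (if m = i then X $$ (a * d + m, b * d + l) * cnj (x (a * d + r)) * x (b * d + s) else 0) else 0)"
        unfolding g_def sesq_def sum_split_product_index
        by (rule sum.cong[OF refl])+ (simp add: w)
      also have "\<dots> = (\<Sum>a<k. \<Sum>m<d. if m = i then
          (\<Sum>b<k. X $$ (a * d + m, b * d + j) * cnj (x (a * d + r)) * x (b * d + s)) else 0)"
        by (rule sum.cong[OF refl], rule sum.cong[OF refl]) (use that in simp)
      also have "\<dots> = (\<Sum>a<k. \<Sum>b<k. X $$ (a * d + i, b * d + j) * cnj (x (a * d + r)) * x (b * d + s))"
        using that by simp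
      finally show ?thesis .
    qed
    have "sesq (k * d) Y x x = (\<Sum>a<k. \<Sum>r<d. \<Sum>b<k. \<Sum>s<d. \<Sum>i<d. \<Sum>j<d.
        F (mat_unit d i j) $$ (r, s) * (X $$ (a * d + i, b * d + j) * cnj (x (a * d + r)) * x (b * d + s)))"
      unfolding sesq_def sum_split_product_index
      by (rule sum.cong[OF refl])+ (simp add: Y sum_distrib_left sum_distrib_right mult_ac)
    also have "\<dots> = (\<Sum>i<d. \<Sum>r<d. \<Sum>j<d. \<Sum>s<d. F (mat_unit d i j) $$ (r, s) *
        (\<Sum>a<k. \<Sum>b<k. X $$ (a * d + i, b * d + j) * cnj (x (a * d + r)) * x (b * d + s)))"
      unfolding sum_distrib_left by (rule sum_reorder6)
    also have "\<dots> = (\<Sum>i<d. \<Sum>r<d. \<Sum>j<d. \<Sum>s<d. K (i, r) (j, s) * g (i, r) (j, s))"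
      by (intro sum.cong refl) (simp add: g K_def)
    also have "\<dots> = (\<Sum>p\<in>{..<d} \<times> {..<d}. \<Sum>q\<in>{..<d} \<times> {..<d}. K p q * g p q)"
      by (simp add: sum.cartesian_product')
    finally have form: "sesq (k * d) Y x x = \<dots>" .
    show ?thesis
      unfolding form
    proof (rule Re_sum_near_diagonal_nonneg)
      show "2 * cmod (g p q) \<le> Re (g p p) + Re (g q q)" for p q
        unfolding g_def using psd by (rule psd_cross_term)
      show "cmod (K p q - (if p = q then complex_of_real (1 / d) else 0)) \<le> 1 / real d ^ 3"
        if "p \<in> {..<d} \<times> {..<d}" "q \<in> {..<d} \<times> {..<d}" for p q
        using that unfolding K_def prod_eq_iff by (intro near) auto
      \<comment> \<open>The tolerance was chosen for this: there are \<open>d ^ 2\<close> index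
        pairs and the diagonal weight is \<open>1 / d\<close>.\<close>
      show "1 / real d ^ 3 * card ({..<d} \<times> {..<d}) \<le> 1 / d"
        by (simp add: card_cartesian_product field_simps power3_eq_cube)
    qed auto
  qed
  ultimately show "psd_mat (k * d) (map_tensor k d (\<lambda>Y. Y) F X)"
    by (simp add: psd_mat_iff Y_def)
qed

section \<open>Uniform depolarizing maps on matrix units\<close>

text \<open>With equal parameters the map is \<open>t\<close> times the identity map plus
  \<open>1 - t\<close> times \<open>X \<mapsto> tr X / 2 * 1\<close>. The proof checks all sixteen
  index combinations.\<close>

lemma depolarizing_mat_unit:
  assumes "k < 2" "l < 2" "r < 2" "s < 2"
  shows "depolarizing t t t (mat_unit 2 k l) $$ (r, s) =
    (if k = r \<and> l = s then complex_of_real t else 0) +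
    (if k = l \<and> r = s then complex_of_real ((1 - t) / 2) else 0)"
proof -
  have mult: "(A * B) $$ (i, j) = A $$ (i, 0) * B $$ (0, j) + A $$ (i, 1) * B $$ (1, j)"
    if "A \<in> carrier_mat 2 2" "B \<in> carrier_mat 2 2" "i < 2" "j < 2" for A B :: "complex mat" and i j
    using that by (simp add: scalar_prod_def numeral_2_eq_2)
  have conj: "(P * X * P) $$ (i, j) =
      (P $$ (i, 0) * X $$ (0, 0) + P $$ (i, 1) * X $$ (1, 0)) * P $$ (0, j) +
      (P $$ (i, 0) * X $$ (0, 1) + P $$ (i, 1) * X $$ (1, 1)) * P $$ (1, j)"
    if "P \<in> carrier_mat 2 2" "X \<in> carrier_mat 2 2" "i < 2" "j < 2" for P X :: "complex mat" and i j
    using that by (simp add: mult mult_carrier_mat[of P 2 2 X 2] algebra_simps del: index_mult_mat(1))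
  have entries:
    "pauli_x $$ (0, 0) = 0" "pauli_x $$ (0, 1) = 1" "pauli_x $$ (1, 0) = 1" "pauli_x $$ (1, 1) = 0"
    "pauli_y $$ (0, 0) = 0" "pauli_y $$ (0, 1) = - \<i>" "pauli_y $$ (1, 0) = \<i>" "pauli_y $$ (1, 1) = 0"
    "pauli_z $$ (0, 0) = 1" "pauli_z $$ (0, 1) = 0" "pauli_z $$ (1, 0) = 0" "pauli_z $$ (1, 1) = - 1"
    by (simp_all add: pauli_x_def pauli_y_def pauli_z_def mat_of_rows_list_def)
  have L: "depolarizing t t t X $$ (i, j) = 1 / 4 *
     (complex_of_real (1 + t + t + t) * X $$ (i, j) +
      complex_of_real (1 + t - t - t) * (pauli_x * X * pauli_x) $$ (i, j) +
      complex_of_real (1 - t + t - t) * (pauli_y * X * pauli_y) $$ (i, j) +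
      complex_of_real (1 - t - t + t) * (pauli_z * X * pauli_z) $$ (i, j))"
    if "X \<in> carrier_mat 2 2" "i < 2" "j < 2" for X i j
    using that pauli_carrier[THEN carrier_matD(1)] pauli_carrier[THEN carrier_matD(2)]
    by (simp add: depolarizing_def del: index_mult_mat(1))
  have rs: "r = 0 \<or> r = 1" "s = 0 \<or> s = 1" "k = 0 \<or> k = 1" "l = 0 \<or> l = 1"
    using assms by auto
  show ?thesis
    unfolding L[OF mat_unit_carrier assms(3,4)]
      conj[OF pauli_carrier(1) mat_unit_carrier assms(3,4)]
      conj[OF pauli_carrier(2) mat_unit_carrier assms(3,4)]
      conj[OF pauli_carrier(3) mat_unit_carrier assms(3,4)]
    using rs
    by (elim disjE) (simp_all add: entries index_mat_unit field_simps del: One_nat_def)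
qed

lemma mat_linear_qubit_tensor:
  assumes "\<And>i. i \<in> {1..n} \<Longrightarrow> mat_linear 2 (F i)"
  shows "mat_linear (2 ^ n) (qubit_tensor n F)"
proof (cases n)
  case 0
  then show ?thesis by (simp add: mat_linear_def)
next
  case (Suc m)
  then show ?thesis
    using mat_linear_map_tensor[of "2 ^ m" 2] by (simp add: mult.commute)
qed

text \<open>A matrix unit of size \<open>p * q\<close> is the Kronecker product of the units given
  by the quotients and remainders of its indices modulo \<open>q\<close>.\<close>

lemma index_map_tensor_mat_unit:
  assumes F: "mat_linear p F" and G: "mat_linear q G"
    and bounds: "i < p * q" "j < p * q" "r < p * q" "s < p * q"
  shows "map_tensor p q F G (mat_unit (p * q) i j) $$ (r, s) =
    F (mat_unit p (i div q) (j div q)) $$ (r div q, s div q) *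
    G (mat_unit q (i mod q) (j mod q)) $$ (r mod q, s mod q)"
proof -
  have q: "0 < q" using bounds by (cases q) auto
  have eq_iff: "m = l \<longleftrightarrow> m div q = l div q \<and> m mod q = l mod q" for m l :: nat
    by (metis div_mult_mod_eq)
  have "mat_unit (p * q) i j = kron (mat_unit p (i div q) (j div q)) (mat_unit q (i mod q) (j mod q))"
    using q by (intro eq_matI)
      (auto simp: mat_unit_def kron_def less_mult_imp_div_less eq_iff[of _ i] eq_iff[of _ j])
  then have "map_tensor p q F G (mat_unit (p * q) i j) $$ (r, s) =
      kron (F (mat_unit p (i div q) (j div q))) (G (mat_unit q (i mod q) (j mod q))) $$
        (r div q * q + r mod q, s div q * q + s mod q)"
    by (simp add: map_tensor_kron[OF F G])
  also have "\<dots> = F (mat_unit p (i div q) (j div q)) $$ (r div q, s div q) *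
      G (mat_unit q (i mod q) (j mod q)) $$ (r mod q, s mod q)"
    by (rule index_kron[where p = p and q = q]) (use bounds q mat_linear_carrier[OF F] mat_linear_carrier[OF G]
      in \<open>simp_all add: less_mult_imp_div_less\<close>)
  finally show ?thesis .
qed

abbreviation uniform_depolarizing :: "nat \<Rightarrow> real \<Rightarrow> complex mat \<Rightarrow> complex mat" where
  "uniform_depolarizing n t \<equiv> qubit_tensor n (\<lambda>_. depolarizing t t t)"

text \<open>Splits off the last qubit, that is, the last binary digit of every index. The next two
  inductions rest on it.\<close>

lemma index_uniform_depolarizing_Suc:
  assumes "i < 2 ^ Suc n" "j < 2 ^ Suc n" "r < 2 ^ Suc n" "s < 2 ^ Suc n"
  shows "uniform_depolarizing (Suc n) t (mat_unit (2 ^ Suc n) i j) $$ (r, s) =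
    uniform_depolarizing n t (mat_unit (2 ^ n) (i div 2) (j div 2)) $$ (r div 2, s div 2) *
    depolarizing t t t (mat_unit 2 (i mod 2) (j mod 2)) $$ (r mod 2, s mod 2)"
  using index_map_tensor_mat_unit[of "2 ^ n" "uniform_depolarizing n t" 2 "depolarizing t t t" i j r s] assms
  by (simp add: mat_linear_qubit_tensor mat_linear_depolarizing mult.commute)

text \<open>Every single-qubit factor is real and unchanged when \<open>k\<close>, \<open>l\<close>
  and \<open>r\<close>, \<open>s\<close> are swapped simultaneously.\<close>

lemma uniform_depolarizing_mat_unit_cnj:
  assumes "i < 2 ^ n" "j < 2 ^ n" "r < 2 ^ n" "s < 2 ^ n"
  shows "cnj (uniform_depolarizing n t (mat_unit (2 ^ n) i j) $$ (r, s)) =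
    uniform_depolarizing n t (mat_unit (2 ^ n) j i) $$ (s, r)"
  using assms
proof (induction n arbitrary: i j r s)
  case 0
  then show ?case by (simp add: index_mat_unit)
next
  case (Suc n)
  have "m div 2 < 2 ^ n" if "m < 2 ^ Suc n" for m :: nat
    using that by auto
  with Suc show ?case
    unfolding index_uniform_depolarizing_Suc[OF Suc.prems]
      index_uniform_depolarizing_Suc[OF Suc.prems(2,1,4,3)]
    by (simp add: depolarizing_mat_unit)
qed

text \<open>Each qubit contributes a factor tending to \<open>1 / 2\<close> or 0, and indices agree
  iff all their binary digits do. The limit is one-sided because \<open>t\<close> will be taken
  positive.\<close>

lemma uniform_depolarizing_mat_unit_tendsto:
  assumes "i < 2 ^ n" "j < 2 ^ n" "r < 2 ^ n" "s < 2 ^ n"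
  shows "((\<lambda>t. uniform_depolarizing n t (mat_unit (2 ^ n) i j) $$ (r, s)) \<longlongrightarrow>
    (if i = j \<and> r = s then 1 / 2 ^ n else 0)) (at_right 0)"
  using assms
proof (induction n arbitrary: i j r s)
  case 0
  then show ?case by (simp add: index_mat_unit)
next
  case (Suc n)
  have less: "m div 2 < 2 ^ n" if "m < 2 ^ Suc n" for m :: nat
    using that by auto
  have eq_iff: "m = l \<longleftrightarrow> m div 2 = l div 2 \<and> m mod 2 = l mod 2" for m l :: nat
    by (metis div_mult_mod_eq)
  have "((\<lambda>t. depolarizing t t t (mat_unit 2 k l) $$ (u, v)) \<longlongrightarrow>
      (if k = l \<and> u = v then 1 / 2 else 0)) (at_right 0)"
    if "k < 2" "l < 2" "u < 2" "v < 2" for k l u v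
  proof -
    have "((\<lambda>t. if P then complex_of_real t else 0) \<longlongrightarrow> 0) (at_right 0)"
      "((\<lambda>t. if P then complex_of_real ((1 - t) / 2) else 0) \<longlongrightarrow> (if P then 1 / 2 else 0)) (at_right 0)" for P
      by (cases P; auto intro!: tendsto_eq_intros)+
    from tendsto_add[OF this] show ?thesis
      unfolding depolarizing_mat_unit[OF that] by simp
  qed
  then have "((\<lambda>t. uniform_depolarizing (Suc n) t (mat_unit (2 ^ Suc n) i j) $$ (r, s)) \<longlongrightarrow>
      (if i div 2 = j div 2 \<and> r div 2 = s div 2 then 1 / 2 ^ n else 0) *
      (if i mod 2 = j mod 2 \<and> r mod 2 = s mod 2 then 1 / 2 else 0)) (at_right 0)"
    unfolding index_uniform_depolarizing_Suc[OF Suc.prems]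
    by (intro tendsto_mult Suc.IH less Suc.prems) simp_all
  also have "(if i div 2 = j div 2 \<and> r div 2 = s div 2 then 1 / 2 ^ n else 0) *
      (if i mod 2 = j mod 2 \<and> r mod 2 = s mod 2 then 1 / 2 else 0) =
      (if i = j \<and> r = s then 1 / 2 ^ Suc n else (0::complex))"
    by (simp add: eq_iff[of i j] eq_iff[of r s])
  finally show ?case .
qed

section \<open>The given map on matrix units and the choice of the parameter\<close>

text \<open>Matrix units off the diagonal are not Hermitian, but the combination \<open>H\<close>
  below is for every \<open>c\<close>, so its image is Hermitian too.\<close>

lemma hermiticity_preserving_mat_unit_cnj:
  assumes lin: "mat_linear d F" and herm: "hermiticity_preserving d F"
    and bounds: "i < d" "j < d" "r < d" "s < d"
  shows "cnj (F (mat_unit d i j) $$ (r, s)) = F (mat_unit d j i) $$ (s, r)"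
proof -
  have eq: "cnj (c * F (mat_unit d i j) $$ (r, s) + cnj c * F (mat_unit d j i) $$ (r, s)) =
      c * F (mat_unit d i j) $$ (s, r) + cnj c * F (mat_unit d j i) $$ (s, r)" for c
  proof -
    define H where "H = c \<cdot>\<^sub>m mat_unit d i j + cnj c \<cdot>\<^sub>m mat_unit d j i"
    have "mat_unit d k l $$ (u, v) = mat_unit d l k $$ (v, u)"
      "cnj (mat_unit d k l $$ (u, v)) = mat_unit d k l $$ (u, v)" if "u < d" "v < d" for k l u v
      using that by (auto simp: index_mat_unit)
    then have "hermitian_mat d H"
      unfolding hermitian_mat_iff H_def by (simp add: add.commute)
    then have FH: "hermitian_mat d (F H)"
      using herm by (simp add: hermiticity_preserving_def)
    have "F H = c \<cdot>\<^sub>m F (mat_unit d i j) + cnj c \<cdot>\<^sub>m F (mat_unit d j i)"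
      using lin by (simp add: mat_linear_def H_def)
    moreover have "dim_row (F (mat_unit d k l)) = d" "dim_col (F (mat_unit d k l)) = d" for k l
      using mat_linear_carrier[OF lin, of "mat_unit d k l"] by auto
    ultimately have "F H $$ (u, v) = c * F (mat_unit d i j) $$ (u, v) + cnj c * F (mat_unit d j i) $$ (u, v)"
      if "u < d" "v < d" for u v
      using that by simp
    with FH bounds show ?thesis
      by (auto simp: hermitian_mat_iff simp del: complex_cnj_add complex_cnj_mult)
  qed
  show ?thesis
    \<comment> \<open>\<open>c = 1\<close> relates the sums of the two images and
      \<open>c = \<i>\<close> their differences; together they isolate each image.\<close>
    using eq[of 1] eq[of \<i>] by (simp add: complex_eq_iff)
qed

lemma mat_linear_comp:
  "mat_linear d F \<Longrightarrow> mat_linear d G \<Longrightarrow> mat_linear d (F \<circ> G)"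
  by (auto simp: mat_linear_def)

lemma mat_trace_mat_unit:
  "i < d \<Longrightarrow> mat_trace (mat_unit d i j) = (if i = j then 1 else 0)"
  by (auto simp: mat_trace_def mat_unit_def)

theorem theorem2:
  fixes n :: nat and A :: "complex mat \<Rightarrow> complex mat"
  assumes "n \<ge> 1"
    and "ncp_map (2 ^ n) A"
    and "trace_preserving (2 ^ n) A"
  shows "\<exists>\<alpha> \<beta> \<gamma> :: nat \<Rightarrow> real.
    (\<forall>i\<in>{1..n}. \<alpha> i \<in> {-1..1} - {0} \<and> \<beta> i \<in> {-1..1} - {0} \<and> \<gamma> i \<in> {-1..1} - {0}) \<and>
    completely_positive (2 ^ n)
      (qubit_tensor n (\<lambda>i. depolarizing (\<alpha> i) (\<beta> i) (\<gamma> i)) \<circ> A)"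
proof -
  define d :: nat where "d = 2 ^ n"
  let ?B = "uniform_depolarizing n"
  have A: "mat_linear d A" and herm_A: "hermiticity_preserving d A"
    using assms(2) by (simp_all add: ncp_map_def d_def)
  have B: "mat_linear d (?B t)" for t
    unfolding d_def by (intro mat_linear_qubit_tensor mat_linear_depolarizing)
  \<comment> \<open>The coefficients coming from \<open>A\<close> do not depend on \<open>t\<close>,
    so conjugation and the limit can be taken term by term.\<close>
  have BA: "(?B t \<circ> A) (mat_unit d i j) $$ (r, s) =
      (\<Sum>k<d. \<Sum>l<d. A (mat_unit d i j) $$ (k, l) * ?B t (mat_unit d k l) $$ (r, s))"
    if "r < d" "s < d" for t i j r s
    using mat_linear_expand[OF B mat_linear_carrier[OF A mat_unit_carrier] that] by simp
  have herm: "cnj ((?B t \<circ> A) (mat_unit d i j) $$ (r, s)) = (?B t \<circ> A) (mat_unit d j i) $$ (s, r)"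
    if "i < d" "j < d" "r < d" "s < d" for t i j r s
  proof -
    have B_cnj: "cnj (?B t (mat_unit d k l) $$ (r, s)) = ?B t (mat_unit d l k) $$ (s, r)"
      if "k < d" "l < d" for k l
      using uniform_depolarizing_mat_unit_cnj[of k n l r s] that \<open>r < d\<close> \<open>s < d\<close> by (simp add: d_def)
    have "cnj ((?B t \<circ> A) (mat_unit d i j) $$ (r, s)) =
        (\<Sum>k<d. \<Sum>l<d. A (mat_unit d j i) $$ (l, k) * ?B t (mat_unit d l k) $$ (s, r))"
      unfolding BA[OF that(3,4)] cnj_sum complex_cnj_mult
      by (intro sum.cong refl arg_cong2[where f = "(*)"])
        (use that in \<open>simp_all add: B_cnj hermiticity_preserving_mat_unit_cnj[OF A herm_A]\<close>)
    also have "\<dots> = (?B t \<circ> A) (mat_unit d j i) $$ (s, r)"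
      unfolding BA[OF that(4,3)] by (rule sum.swap)
    finally show ?thesis .
  qed
  have lim: "((\<lambda>t. (?B t \<circ> A) (mat_unit d i j) $$ (r, s)) \<longlongrightarrow>
      (if i = j \<and> r = s then complex_of_real (1 / d) else 0)) (at_right 0)"
    if "i < d" "j < d" "r < d" "s < d" for i j r s
  proof -
    have "((\<lambda>t. (?B t \<circ> A) (mat_unit d i j) $$ (r, s)) \<longlongrightarrow>
        (\<Sum>k<d. \<Sum>l<d. A (mat_unit d i j) $$ (k, l) * (if k = l \<and> r = s then 1 / 2 ^ n else 0))) (at_right 0)"
      unfolding BA[OF that(3,4)]
      by (intro tendsto_sum tendsto_mult tendsto_const)
        (use that uniform_depolarizing_mat_unit_tendsto in \<open>simp add: d_def\<close>)
    also have "(\<Sum>k<d. \<Sum>l<d. A (mat_unit d i j) $$ (k, l) * (if k = l \<and> r = s then 1 / 2 ^ n else 0)) =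
        (\<Sum>k<d. \<Sum>l<d. if k = l then A (mat_unit d i j) $$ (k, l) * (if r = s then complex_of_real (1 / d) else 0) else 0)"
      by (intro sum.cong refl) (simp add: d_def)
    also have "\<dots> = (\<Sum>k<d. A (mat_unit d i j) $$ (k, k)) * (if r = s then complex_of_real (1 / d) else 0)"
      by (simp add: sum_distrib_right)
    \<comment> \<open>Only \<open>k = l\<close> survives in the limit, which leaves a trace that
      trace preservation evaluates.\<close>
    also have "(\<Sum>k<d. A (mat_unit d i j) $$ (k, k)) = mat_trace (A (mat_unit d i j))"
      using carrier_matD[OF mat_linear_carrier[OF A mat_unit_carrier]] by (simp add: mat_trace_def)
    also have "\<dots> = (if i = j then 1 else 0)"
      using assms(3) that by (simp add: trace_preserving_def mat_trace_mat_unit flip: d_def)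
    finally show ?thesis by (simp split: if_splits)
  qed
  have "0 < 1 / real d ^ 3" by (simp add: d_def)
  \<comment> \<open>There are finitely many entries, so one neighbourhood of 0 serves them
    all.\<close>
  then have "\<forall>\<^sub>F t in at_right 0. \<forall>i\<in>{..<d}. \<forall>j\<in>{..<d}. \<forall>r\<in>{..<d}. \<forall>s\<in>{..<d}.
      dist ((?B t \<circ> A) (mat_unit d i j) $$ (r, s)) (if i = j \<and> r = s then complex_of_real (1 / d) else 0) < 1 / real d ^ 3"
    by (intro eventually_ball_finite ballI finite_lessThan tendstoD[OF lim]) auto
  \<comment> \<open>This keeps \<open>t\<close> nonzero and inside the admissible parameter
    range.\<close>
  moreover have "\<forall>\<^sub>F t in at_right 0. t \<in> {0<..<1::real}"
    by (rule eventually_at_right_real) simp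
  ultimately have "\<forall>\<^sub>F t in at_right 0. t \<in> {0<..<1} \<and>
      (\<forall>i\<in>{..<d}. \<forall>j\<in>{..<d}. \<forall>r\<in>{..<d}. \<forall>s\<in>{..<d}.
        dist ((?B t \<circ> A) (mat_unit d i j) $$ (r, s)) (if i = j \<and> r = s then complex_of_real (1 / d) else 0) < 1 / real d ^ 3)"
    by eventually_elim simp
  from eventually_happens'[OF trivial_limit_at_right_real this]
  obtain t where t: "t \<in> {0<..<1}" and
    near: "\<forall>i\<in>{..<d}. \<forall>j\<in>{..<d}. \<forall>r\<in>{..<d}. \<forall>s\<in>{..<d}.
      dist ((?B t \<circ> A) (mat_unit d i j) $$ (r, s)) (if i = j \<and> r = s then complex_of_real (1 / d) else 0) < 1 / real d ^ 3"
    by blast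
  have "completely_positive d (?B t \<circ> A)"
  proof (rule completely_positive_near_trace_map[OF mat_linear_comp[OF B A] herm])
    show "cmod ((?B t \<circ> A) (mat_unit d i j) $$ (r, s) - (if i = j \<and> r = s then complex_of_real (1 / d) else 0)) \<le> 1 / real d ^ 3"
      if "i < d" "j < d" "r < d" "s < d" for i j r s
      using near that unfolding dist_norm by (intro less_imp_le) simp
  qed
  with t show ?thesis
    by (intro exI[of _ "\<lambda>_. t"]) (simp add: d_def)
qed

end
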